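(* Let $R$ be a commutative ring with identity, let $T$ be a subgroup of the group of units of $R$, let $T_0=T\cup\{0\}$, and let $\prec$ be a total ordering on $T_0$ with $\min(T_0)=1$ and $\max(T_0)=0$. Let $m,n\ge 1$. Then every matrix in $T_0^{m\times n}$ is equivalent to a matrix in $T_0^{m\times n}$ that is in standard form.
   Context: $T_0^{m\times n}$ denotes the set of $m\times n$ matrices with entries in $T_0$. Lexicographic order: for row vectors $a=(a_1,\dots,a_n)$ and $b=(b_1,\dots,b_n)$ with entries in $T_0$, if $k$ is the smallest index with $a_k\ne b_k$, write $a<b$ provided $a_k\prec b_k$; write $a\le b$ if $a<b$ or $a=b$. The rows $a_1,\dots,a_m$ of a matrix are in lexicographical order if $a_1\le a_2\le\cdots\le a_m$. Standard form: a matrix in $T_0^{m\times n}$ is in standard form if all of the following hold: (S1) the first non-zero entry in each row is $1$ (no condition on zero rows); (S2) the first non-zero entry in each column is $1$ (no condition on zero columns); (S3) the first row is ones followed by zeros, i.e. of the form $(1,\dots,1,0,\dots,0)$, where the number of ones and the number of zeros may each be $0$; (S4) the rows are in lexicographical order according to $\prec$. Monomial matrices: for $m \ge 1$, let $\mathbb{M}_m\subset T_0^{m\times m}$ be the set of products $PD$, where $P$ is an $m\times m$ permutation matrix and $D$ is a diagonal matrix with all diagonal entries in $T$. Equivalence: $A,B\in T_0^{m\times n}$ are equivalent if there exist $M_1\in\mathbb{M}_m$ and $M_2\in\mathbb{M}_n$ such that $M_1AM_2=B$. *)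

theory Defs
  imports "HOL-Combinatorics.Permutations" "Jordan_Normal_Form.Matrix"
begin

(* Rings are given by the sort {comm_ring, comm_monoid_mult}: commutative rings with identity,
   the zero ring included (comm_ring_1 would add the axiom 0 \<noteq> 1). *)

definition unit_group :: "'a::{comm_ring, comm_monoid_mult} monoid" where
  "unit_group = units_of \<lparr>carrier = UNIV, monoid.mult = (*), one = 1\<rparr>"

(* The argument prec is the strict order; only its restriction to S is relevant. *)
definition strict_total_order_on :: "'a set \<Rightarrow> ('a \<Rightarrow> 'a \<Rightarrow> bool) \<Rightarrow> bool" where
  "strict_total_order_on S prec \<longleftrightarrow> irreflp_on S prec \<and> transp_on S prec \<and> totalp_on S prec"

definition is_min_of :: "('a \<Rightarrow> 'a \<Rightarrow> bool) \<Rightarrow> 'a set \<Rightarrow> 'a \<Rightarrow> bool" where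
  "is_min_of prec S a \<longleftrightarrow> a \<in> S \<and> (\<forall>x\<in>S. a = x \<or> prec a x)"

definition is_max_of :: "('a \<Rightarrow> 'a \<Rightarrow> bool) \<Rightarrow> 'a set \<Rightarrow> 'a \<Rightarrow> bool" where
  "is_max_of prec S a \<longleftrightarrow> a \<in> S \<and> (\<forall>x\<in>S. x = a \<or> prec x a)"

definition mats_over :: "'a set \<Rightarrow> nat \<Rightarrow> nat \<Rightarrow> 'a mat set" where
  "mats_over S m n = {A \<in> carrier_mat m n. elements_mat A \<subseteq> S}"

definition lex_less :: "('a \<Rightarrow> 'a \<Rightarrow> bool) \<Rightarrow> 'a vec \<Rightarrow> 'a vec \<Rightarrow> bool" where
  "lex_less prec a b \<longleftrightarrow>
     (\<exists>k < dim_vec a. (\<forall>j<k. a $ j = b $ j) \<and> a $ k \<noteq> b $ k \<and> prec (a $ k) (b $ k))"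

definition lex_le :: "('a \<Rightarrow> 'a \<Rightarrow> bool) \<Rightarrow> 'a vec \<Rightarrow> 'a vec \<Rightarrow> bool" where
  "lex_le prec a b \<longleftrightarrow> lex_less prec a b \<or> a = b"

definition first_nonzero_is_1 :: "'a::{zero, one} vec \<Rightarrow> bool" where
  "first_nonzero_is_1 v \<longleftrightarrow>
     (\<forall>k < dim_vec v. v $ k \<noteq> 0 \<and> (\<forall>j<k. v $ j = 0) \<longrightarrow> v $ k = 1)"

definition standard_form :: "('a::{zero, one} \<Rightarrow> 'a \<Rightarrow> bool) \<Rightarrow> 'a mat \<Rightarrow> bool" where
  "standard_form prec A \<longleftrightarrow>
     (\<forall>i < dim_row A. first_nonzero_is_1 (row A i)) \<and>
     (\<forall>j < dim_col A. first_nonzero_is_1 (col A j)) \<and>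
     (\<exists>r \<le> dim_col A. row A 0 = vec (dim_col A) (\<lambda>j. if j < r then 1 else 0)) \<and>
     (\<forall>i. Suc i < dim_row A \<longrightarrow> lex_le prec (row A i) (row A (Suc i)))"

definition permutation_mat :: "nat \<Rightarrow> (nat \<Rightarrow> nat) \<Rightarrow> 'a::{zero, one} mat" where
  "permutation_mat m p = mat m m (\<lambda>(i, j). if j = p i then 1 else 0)"

definition monomial_mats :: "'a::{comm_ring, comm_monoid_mult} set \<Rightarrow> nat \<Rightarrow> 'a mat set" where
  "monomial_mats T m =
     {permutation_mat m p * mat_diag m d | p d. p permutes {..<m} \<and> (\<forall>i<m. d i \<in> T)}"

(* The first argument is the subgroup T, not T0. *)
definition mat_equivalent ::
    "'a::{comm_ring, comm_monoid_mult} set \<Rightarrow> 'a mat \<Rightarrow> 'a mat \<Rightarrow> bool" where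
  "mat_equivalent T A B \<longleftrightarrow>
     (\<exists>M1 \<in> monomial_mats T (dim_row A). \<exists>M2 \<in> monomial_mats T (dim_col A). M1 * A * M2 = B)"

end

theory Submission
  imports Defs
begin

text \<open>
  Reading the entries of a matrix row by row, compare the matrices equivalent to \<open>A\<close>
  lexicographically with respect to \<open>prec\<close>. A least matrix in its equivalence class is in
  standard form, since rescaling a row or a column, swapping two adjacent rows, or swapping two
  columns cannot make it smaller.

  As \<open>prec\<close> need not be well-founded, the existence of a least matrix is not automatic. Fix the
  entries before a given position. For fixed row and column permutations, the entry there is
  either determined or it can be rescaled freely by \<open>T\<close>. Hence either \<open>1\<close>, the least
  element of \<open>T0\<close>, occurs there, or only finitely many values occur.
\<close>

section \<open>Equivalence as permutation and rescaling of rows and columns\<close>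

lemma subgroup_unit_groupD:
  fixes T :: "'a::{comm_ring, comm_monoid_mult} set"
  assumes "subgroup T unit_group"
  shows "1 \<in> T"
    and "\<And>s t. s \<in> T \<Longrightarrow> t \<in> T \<Longrightarrow> s * t \<in> T"
    and "\<And>t. t \<in> T \<Longrightarrow> \<exists>u\<in>T. u * t = 1"
proof -
  let ?M = "\<lparr>carrier = UNIV, monoid.mult = (*), one = 1\<rparr> :: 'a monoid"
  interpret subgroup T unit_group by fact
  have mult: "monoid.mult unit_group = ((*) :: 'a \<Rightarrow> 'a \<Rightarrow> 'a)" and one: "\<one>\<^bsub>unit_group\<^esub> = (1::'a)"
    by (simp_all add: unit_group_def units_of_def)
  \<comment> \<open>A subgroup is closed under the inverse operation of \<open>unit_group\<close>.
    That this operation yields actual inverses requires the units to form a group, which holds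
    because the ring is a multiplicative monoid.\<close>
  have "monoid ?M" by unfold_locales (auto simp: mult.assoc)
  then have grp: "group (unit_group :: 'a monoid)"
    unfolding unit_group_def by (rule monoid.units_group)
  show "1 \<in> T" using one_closed by (simp add: one)
  show "\<And>s t. s \<in> T \<Longrightarrow> t \<in> T \<Longrightarrow> s * t \<in> T" using m_closed by (simp add: mult)
  show "\<exists>u\<in>T. u * t = 1" if "t \<in> T" for t
    using m_inv_closed[OF that] group.l_inv[OF grp mem_carrier[OF that]]
    unfolding mult one by blast
qed

lemma permutation_mat_mult:
  fixes A :: "'a::{comm_ring, comm_monoid_mult} mat"
  assumes "p permutes {..<m}" "A \<in> carrier_mat m n"
  shows "permutation_mat m p * A = mat m n (\<lambda>(i, j). A $$ (p i, j))"
proof (rule eq_matI)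
  fix i j assume "i < dim_row (mat m n (\<lambda>(i, j). A $$ (p i, j)))"
    and "j < dim_col (mat m n (\<lambda>(i, j). A $$ (p i, j)))"
  then have ij: "i < m" "j < n" by auto
  then have pi: "p i < m" using permutes_in_image[OF assms(1), of i] by simp
  have "(permutation_mat m p * A) $$ (i, j) =
      (\<Sum>k = 0..<m. (if k = p i then 1 else 0) * A $$ (k, j))"
    using ij assms(2) by (simp add: permutation_mat_def scalar_prod_def)
  also have "\<dots> = (\<Sum>k = 0..<m. if k = p i then A $$ (k, j) else 0)"
    by (rule sum.cong) auto
  also have "\<dots> = A $$ (p i, j)" using pi by simp
  finally show "(permutation_mat m p * A) $$ (i, j) = mat m n (\<lambda>(i, j). A $$ (p i, j)) $$ (i, j)"
    using ij by simp
qed (use assms in \<open>auto simp: permutation_mat_def\<close>)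

text \<open>The 1 in row \<open>k\<close> of the permutation matrix stands in column
  \<open>p k\<close>, so column \<open>k\<close> of \<open>A\<close> is moved to column
  \<open>p k\<close>. Reading off column \<open>j\<close> of the product therefore needs the inverse
  of \<open>p\<close>, in contrast to multiplication on the left.\<close>

lemma mult_permutation_mat:
  fixes A :: "'a::{comm_ring, comm_monoid_mult} mat"
  assumes "p permutes {..<n}" "A \<in> carrier_mat m n"
  shows "A * permutation_mat n p = mat m n (\<lambda>(i, j). A $$ (i, inv_into UNIV p j))"
proof (rule eq_matI)
  fix i j assume "i < dim_row (mat m n (\<lambda>(i, j). A $$ (i, inv_into UNIV p j)))"
    and "j < dim_col (mat m n (\<lambda>(i, j). A $$ (i, inv_into UNIV p j)))"
  then have ij: "i < m" "j < n" by auto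
  then have pj: "inv_into UNIV p j < n"
    using permutes_in_image[OF permutes_inv[OF assms(1)], of j] by simp
  have "(A * permutation_mat n p) $$ (i, j) =
      (\<Sum>k = 0..<n. A $$ (i, k) * (if j = p k then 1 else 0))"
    using ij assms(2) by (simp add: permutation_mat_def scalar_prod_def)
  also have "\<dots> = (\<Sum>k = 0..<n. if k = inv_into UNIV p j then A $$ (i, k) else 0)"
    by (rule sum.cong) (auto simp: permutes_inverses[OF assms(1)])
  also have "\<dots> = A $$ (i, inv_into UNIV p j)" using pj by simp
  finally show "(A * permutation_mat n p) $$ (i, j) = mat m n (\<lambda>(i, j). A $$ (i, inv_into UNIV p j)) $$ (i, j)"
    using ij by simp
qed (use assms in \<open>auto simp: permutation_mat_def\<close>)

text \<open>On the left the diagonal matrix acts before the permutation, hence the factor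
  \<open>d (p i)\<close>. On the right it acts after the permutation, hence \<open>e j\<close> with
  the index unchanged.\<close>

lemma monomial_mats_mult_both_sides:
  fixes A :: "'a::{comm_ring, comm_monoid_mult} mat"
  assumes A: "A \<in> carrier_mat m n" and p: "p permutes {..<m}" and q: "q permutes {..<n}"
  shows "permutation_mat m p * mat_diag m d * A * (permutation_mat n q * mat_diag n e) =
    mat m n (\<lambda>(i, j). d (p i) * A $$ (p i, inv_into UNIV q j) * e j)"
proof -
  have P: "permutation_mat m p \<in> carrier_mat m m" "permutation_mat n q \<in> carrier_mat n n"
    by (auto simp: permutation_mat_def)
  define X where "X = mat m n (\<lambda>(i, j). d i * A $$ (i, j))"
  define Y where "Y = mat m n (\<lambda>(i, j). X $$ (p i, j))"
  have X: "X \<in> carrier_mat m n" and Y: "Y \<in> carrier_mat m n" by (auto simp: X_def Y_def)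
  have "permutation_mat m p * mat_diag m d * A = permutation_mat m p * (mat_diag m d * A)"
    using P A by (intro assoc_mult_mat) auto
  also have "\<dots> = Y"
    unfolding Y_def using mat_diag_mult_left[OF A] permutation_mat_mult[OF p X]
    by (simp add: X_def)
  finally have "permutation_mat m p * mat_diag m d * A * (permutation_mat n q * mat_diag n e) =
      Y * permutation_mat n q * mat_diag n e"
    using assoc_mult_mat[OF Y P(2) mat_diag_dim, of e] by simp
  also have "\<dots> = mat m n (\<lambda>(i, j). Y $$ (i, inv_into UNIV q j) * e j)"
    unfolding mult_permutation_mat[OF q Y]
    by (subst mat_diag_mult_right) auto
  also have "\<dots> = mat m n (\<lambda>(i, j). d (p i) * A $$ (p i, inv_into UNIV q j) * e j)"
  proof (rule eq_matI; clarsimp)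
    fix i j assume "i < m" "j < n"
    moreover from this have "p i < m" "inv_into UNIV q j < n"
      using permutes_in_image[OF p, of i] permutes_in_image[OF permutes_inv[OF q], of j] by auto
    ultimately show "Y $$ (i, inv_into UNIV q j) * e j = d (p i) * A $$ (p i, inv_into UNIV q j) * e j"
      by (simp add: X_def Y_def)
  qed
  finally show ?thesis .
qed

text \<open>The permutations are parameters while the scalings are quantified away: there are only
  finitely many pairs of permutations, but possibly infinitely many scalings, and the existence of a
  least matrix rests on counting the pairs.\<close>

definition monomial_transform :: "'a::{comm_ring, comm_monoid_mult} set \<Rightarrow> nat \<Rightarrow> nat \<Rightarrow>
    (nat \<Rightarrow> nat) \<Rightarrow> (nat \<Rightarrow> nat) \<Rightarrow> 'a mat \<Rightarrow> 'a mat \<Rightarrow> bool" where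
  "monomial_transform T m n p q A B \<longleftrightarrow> p permutes {..<m} \<and> q permutes {..<n} \<and>
     (\<exists>r c. (\<forall>i<m. r i \<in> T) \<and> (\<forall>j<n. c j \<in> T) \<and>
       (\<forall>i<m. \<forall>j<n. B $$ (i, j) = r i * A $$ (p i, q j) * c j))"

text \<open>The two descriptions differ by reindexing: the row factors are related by
  \<open>r i = d (p i)\<close>, and the column permutation is replaced by its inverse. Both changes
  are reversible.\<close>

lemma mat_equivalent_iff_monomial_transform:
  fixes A B :: "'a::{comm_ring, comm_monoid_mult} mat"
  assumes A: "A \<in> carrier_mat m n" and B: "B \<in> carrier_mat m n"
  shows "mat_equivalent T A B \<longleftrightarrow> (\<exists>p q. monomial_transform T m n p q A B)"
proof
  assume "mat_equivalent T A B"
  then obtain p d q e where p: "p permutes {..<m}" and d: "\<forall>i<m. d i \<in> T"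
    and q: "q permutes {..<n}" and e: "\<forall>i<n. e i \<in> T"
    and "permutation_mat m p * mat_diag m d * A * (permutation_mat n q * mat_diag n e) = B"
    using A unfolding mat_equivalent_def monomial_mats_def by auto
  then have B: "B = mat m n (\<lambda>(i, j). d (p i) * A $$ (p i, inv_into UNIV q j) * e j)"
    using monomial_mats_mult_both_sides[OF A p q] by simp
  have "\<forall>i<m. d (p i) \<in> T" using d permutes_in_image[OF p] by simp
  then have "monomial_transform T m n p (inv_into UNIV q) A B"
    unfolding monomial_transform_def
    using p permutes_inv[OF q] e B
    by (intro conjI exI[of _ "\<lambda>i. d (p i)"] exI[of _ e]) auto
  then show "\<exists>p q. monomial_transform T m n p q A B" by blast
next
  assume "\<exists>p q. monomial_transform T m n p q A B"
  then obtain p q r c where p: "p permutes {..<m}" and q: "q permutes {..<n}"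
    and r: "\<forall>i<m. r i \<in> T" and c: "\<forall>j<n. c j \<in> T"
    and B': "\<forall>i<m. \<forall>j<n. B $$ (i, j) = r i * A $$ (p i, q j) * c j"
    unfolding monomial_transform_def by auto
  have ip: "\<forall>i<m. r (inv_into UNIV p i) \<in> T" using r permutes_in_image[OF permutes_inv[OF p]] by simp
  have "permutation_mat m p * mat_diag m (\<lambda>i. r (inv_into UNIV p i)) * A *
      (permutation_mat n (inv_into UNIV q) * mat_diag n c) = B"
    unfolding monomial_mats_mult_both_sides[OF A p permutes_inv[OF q]]
    by (rule eq_matI) (use B B' in \<open>auto simp: permutes_inverses[OF p] permutes_inv_inv[OF q]\<close>)
  moreover have "permutation_mat m p * mat_diag m (\<lambda>i. r (inv_into UNIV p i)) \<in> monomial_mats T m"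
    and "permutation_mat n (inv_into UNIV q) * mat_diag n c \<in> monomial_mats T n"
    using p permutes_inv[OF q] c ip unfolding monomial_mats_def by blast+
  ultimately show "mat_equivalent T A B"
    using A unfolding mat_equivalent_def by auto
qed

lemma monomial_transform_refl:
  assumes "subgroup T unit_group"
  shows "monomial_transform T m n id id A A"
  unfolding monomial_transform_def
  by (intro conjI permutes_id exI[of _ "\<lambda>_. 1"]) (auto simp: subgroup_unit_groupD[OF assms])

lemma monomial_transform_trans:
  assumes T: "subgroup T unit_group"
    and "monomial_transform T m n p q A B" and "monomial_transform T m n p' q' B C"
  shows "monomial_transform T m n (p \<circ> p') (q \<circ> q') A C"
proof -
  from assms obtain r c r' c' where p: "p permutes {..<m}" "p' permutes {..<m}"
    and q: "q permutes {..<n}" "q' permutes {..<n}"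
    and r: "\<forall>i<m. r i \<in> T" "\<forall>i<m. r' i \<in> T" and c: "\<forall>j<n. c j \<in> T" "\<forall>j<n. c' j \<in> T"
    and B: "\<forall>i<m. \<forall>j<n. B $$ (i, j) = r i * A $$ (p i, q j) * c j"
    and C: "\<forall>i<m. \<forall>j<n. C $$ (i, j) = r' i * B $$ (p' i, q' j) * c' j"
    unfolding monomial_transform_def by auto
  have p': "p' i < m" if "i < m" for i using permutes_in_image[OF p(2), of i] that by simp
  have q': "q' j < n" if "j < n" for j using permutes_in_image[OF q(2), of j] that by simp
  \<comment> \<open>Row \<open>i\<close> of \<open>C\<close> comes from row \<open>p' i\<close> of
    \<open>B\<close>, which already carries the factor \<open>r (p' i)\<close>; columns behave
    likewise.\<close>
  show ?thesis
    unfolding monomial_transform_def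
    using permutes_compose p q r c p' q' B C
    by (intro conjI exI[of _ "\<lambda>i. r' i * r (p' i)"] exI[of _ "\<lambda>j. c (q' j) * c' j"])
      (auto simp: subgroup_unit_groupD[OF T] mult.assoc)
qed

text \<open>Undoing the scalings that led to \<open>B\<close> and applying those that lead to
  \<open>C\<close> leaves the common permutations untouched, so two matrices obtained with the same
  permutations differ by a rescaling only.\<close>

lemma monomial_transform_compare:
  assumes T: "subgroup T unit_group"
    and "monomial_transform T m n p q A B" and "monomial_transform T m n p q A C"
  shows "monomial_transform T m n id id B C"
proof -
  from assms obtain r c r' c' where r: "\<forall>i<m. r i \<in> T" "\<forall>i<m. r' i \<in> T"
    and c: "\<forall>j<n. c j \<in> T" "\<forall>j<n. c' j \<in> T"
    and B: "\<forall>i<m. \<forall>j<n. B $$ (i, j) = r i * A $$ (p i, q j) * c j"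
    and C: "\<forall>i<m. \<forall>j<n. C $$ (i, j) = r' i * A $$ (p i, q j) * c' j"
    unfolding monomial_transform_def by auto
  from subgroup_unit_groupD(3)[OF T] obtain v where v: "\<And>t. t \<in> T \<Longrightarrow> v t \<in> T \<and> v t * t = 1"
    by metis
  have "C $$ (i, j) = (r' i * v (r i)) * B $$ (i, j) * (v (c j) * c' j)" if "i < m" "j < n" for i j
  proof -
    have "(r' i * v (r i)) * B $$ (i, j) * (v (c j) * c' j) =
        (v (r i) * r i) * (v (c j) * c j) * (r' i * A $$ (p i, q j) * c' j)"
      using B that by (simp add: ac_simps)
    then show ?thesis using v r c C that by simp
  qed
  then show ?thesis
    unfolding monomial_transform_def using r c v
    by (intro conjI permutes_id exI[of _ "\<lambda>i. r' i * v (r i)"] exI[of _ "\<lambda>j. v (c j) * c' j"])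
      (auto simp: subgroup_unit_groupD[OF T])
qed

text \<open>View rows and columns as vertices of a bipartite graph whose edges are the non-zero
  entries on which \<open>B\<close> and \<open>C\<close> agree. Along an edge the row factor and the
  column factor are mutually inverse, so row \<open>i\<close> and column \<open>j\<close> lie in
  different components, as their factors do not cancel. The component of row \<open>i\<close> can
  then be rescaled on its own. In the search for a least matrix this produces the entry 1.\<close>

lemma rescaling_free_entry:
  fixes B C :: "'a::{comm_ring, comm_monoid_mult} mat"
  assumes T: "subgroup T unit_group" and B: "B \<in> mats_over (T \<union> {0}) m n"
    and BC: "monomial_transform T m n id id B C"
    and ij: "i < m" "j < n" and neq: "B $$ (i, j) \<noteq> C $$ (i, j)"
  obtains D where "D \<in> carrier_mat m n" "monomial_transform T m n id id B D" "D $$ (i, j) = 1"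
    "\<And>x y. x < m \<Longrightarrow> y < n \<Longrightarrow> B $$ (x, y) = C $$ (x, y) \<Longrightarrow> D $$ (x, y) = B $$ (x, y)"
proof -
  from BC obtain r c where r: "\<forall>i<m. r i \<in> T" and c: "\<forall>j<n. c j \<in> T"
    and C: "\<forall>i<m. \<forall>j<n. C $$ (i, j) = r i * B $$ (i, j) * c j"
    unfolding monomial_transform_def by auto
  have BT: "B $$ (x, y) \<in> T \<or> B $$ (x, y) = 0" if "x < m" "y < n" for x y
    using B that unfolding mats_over_def by (auto dest!: subsetD)
  have "B $$ (i, j) \<noteq> 0" using neq C ij by auto
  then have "B $$ (i, j) \<in> T" using BT ij by blast
  \<comment> \<open>The factor \<open>t\<close> turns the entry at \<open>(i, j)\<close> into 1. Its
    inverse \<open>t'\<close> compensates in the columns where rows scaled by \<open>t\<close> have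
    entries to be preserved.\<close>
  then obtain t where t: "t \<in> T" "t * B $$ (i, j) = 1" using subgroup_unit_groupD(3)[OF T] by blast
  then obtain t' where t': "t' \<in> T" "t' * t = 1" using subgroup_unit_groupD(3)[OF T] by blast
  from r ij obtain s where s: "s \<in> T" "s * r i = 1" using subgroup_unit_groupD(3)[OF T] by blast
  have rc: "r i * c j \<noteq> 1"
  proof
    assume 1: "r i * c j = 1"
    have "C $$ (i, j) = (r i * c j) * B $$ (i, j)" using C ij by (simp add: ac_simps)
    with 1 neq show False by simp
  qed
  txt \<open>
    A non-zero entry \<open>(x, y)\<close> on which \<open>B\<close> and \<open>C\<close> agree has \<open>r x * c y = 1\<close>, so the rows and
    columns selected below either both contain it or both avoid it.
  \<close>
  define r' where "r' x = (if r x = r i then t else 1)" for x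
  define c' where "c' y = (if r i * c y = 1 then t' else 1)" for y
  define D where "D = mat m n (\<lambda>(x, y). r' x * B $$ (x, y) * c' y)"
  show thesis
  proof
    show "D \<in> carrier_mat m n" by (simp add: D_def)
    show "monomial_transform T m n id id B D"
      unfolding monomial_transform_def D_def
      by (intro conjI permutes_id exI[of _ r'] exI[of _ c'])
        (auto simp: r'_def c'_def t t' subgroup_unit_groupD[OF T])
    show "D $$ (i, j) = 1" using ij rc t by (simp add: D_def r'_def c'_def)
    fix x y assume xy: "x < m" "y < n" and eq: "B $$ (x, y) = C $$ (x, y)"
    show "D $$ (x, y) = B $$ (x, y)"
    proof (cases "B $$ (x, y) = 0")
      case False
      \<comment> \<open>A non-zero entry lies in \<open>T\<close> and is a unit, so it can be
        cancelled even if the ring has zero divisors.\<close>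
      then obtain u where u: "u * B $$ (x, y) = 1" using BT[OF xy] subgroup_unit_groupD(3)[OF T] by blast
      have "r x * c y = (u * B $$ (x, y)) * (r x * c y)" by (simp add: u)
      also have "\<dots> = u * (r x * B $$ (x, y) * c y)" by (simp only: ac_simps)
      also have "\<dots> = 1" using eq C xy u by simp
      finally have rcxy: "r x * c y = 1" .
      have "r x = r i \<longleftrightarrow> r i * c y = 1"
      proof
        assume "r i * c y = 1"
        then have "r x * (r i * c y) = r x" by simp
        moreover have "r x * (r i * c y) = r i * (r x * c y)" by (simp add: ac_simps)
        ultimately show "r x = r i" using rcxy by simp
      qed (use rcxy in simp)
      moreover have "t * B $$ (x, y) * t' = (t' * t) * B $$ (x, y)" by (simp only: ac_simps)
      ultimately show ?thesis using xy t' by (simp add: D_def r'_def c'_def)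
    qed (use xy in \<open>simp add: D_def\<close>)
  qed
qed

section \<open>Existence of a lexicographically least matrix\<close>

lemma finite_has_strict_min:
  assumes "finite V" "V \<noteq> {}" "V \<subseteq> S" "strict_total_order_on S prec"
  shows "\<exists>v\<in>V. \<forall>w\<in>V. v = w \<or> prec v w"
proof -
  have ord: "irreflp_on V prec" "transp_on V prec" "totalp_on V prec"
    using assms(3,4) unfolding strict_total_order_on_def
    by (auto intro: irreflp_on_subset transp_on_subset totalp_on_subset)
  then have "asymp_on V prec" by (meson asymp_on_iff_irreflp_on_if_transp_on)
  then obtain v where "v \<in> V" "\<forall>w\<in>V. w \<noteq> v \<longrightarrow> \<not> prec w v"
    using Finite_Set.bex_min_element[OF assms(1) _ ord(2) assms(2)] by blast
  then show ?thesis using ord(3) by (metis totalp_onD)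
qed

text \<open>Induction on the length \<open>M\<close> of the prefix on which \<open>b\<close> is
  already minimal. Passing to a \<open>b'\<close> with the same first \<open>M\<close> values and
  the least possible value at \<open>M\<close> preserves the earlier minimality, since that concerns
  the first \<open>M\<close> values only. As there are \<open>N\<close> positions, no
  well-foundedness of \<open>prec\<close> is involved.\<close>

lemma lex_least_exists:
  fixes f :: "'b \<Rightarrow> nat \<Rightarrow> 'c"
  assumes "X \<noteq> {}"
    and min: "\<And>b k. b \<in> X \<Longrightarrow> k < N \<Longrightarrow>
      \<exists>b'\<in>X. (\<forall>l<k. f b' l = f b l) \<and>
        (\<forall>c\<in>X. (\<forall>l<k. f c l = f b l) \<longrightarrow> f b' k = f c k \<or> prec (f b' k) (f c k))"
  shows "\<exists>b\<in>X. \<forall>c\<in>X. \<forall>k<N. (\<forall>l<k. f c l = f b l) \<longrightarrow> f b k = f c k \<or> prec (f b k) (f c k)"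
proof -
  have "M \<le> N \<Longrightarrow> \<exists>b\<in>X. \<forall>c\<in>X. \<forall>k<M. (\<forall>l<k. f c l = f b l) \<longrightarrow> f b k = f c k \<or> prec (f b k) (f c k)"
    for M
  proof (induction M)
    case 0
    then show ?case using assms(1) by auto
  next
    case (Suc M)
    then obtain b where b: "b \<in> X"
      "\<And>c k. c \<in> X \<Longrightarrow> k < M \<Longrightarrow> \<forall>l<k. f c l = f b l \<Longrightarrow> f b k = f c k \<or> prec (f b k) (f c k)"
      by (metis Suc_leD)
    obtain b' where b': "b' \<in> X" "\<And>l. l < M \<Longrightarrow> f b' l = f b l"
      "\<And>c. c \<in> X \<Longrightarrow> \<forall>l<M. f c l = f b l \<Longrightarrow> f b' M = f c M \<or> prec (f b' M) (f c M)"
      using min[OF b(1), of M] Suc.prems by auto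
    have "f b' k = f c k \<or> prec (f b' k) (f c k)"
      if "c \<in> X" "k < Suc M" "\<forall>l<k. f c l = f b' l" for c k
    proof (cases "k = M")
      case True
      then show ?thesis using that b' by simp
    next
      case False
      then show ?thesis using that b(2)[of c k] b'(2) by simp
    qed
    then show ?case using b'(1) by blast
  qed
  then show ?thesis by blast
qed

lemma monomial_transform_mats_over:
  assumes T: "subgroup T unit_group" and A: "A \<in> mats_over (T \<union> {0}) m n"
    and B: "B \<in> carrier_mat m n" and "monomial_transform T m n p q A B"
  shows "B \<in> mats_over (T \<union> {0}) m n"
proof -
  from assms obtain r c where p: "p permutes {..<m}" and q: "q permutes {..<n}"
    and r: "\<forall>i<m. r i \<in> T" and c: "\<forall>j<n. c j \<in> T"
    and eq: "\<forall>i<m. \<forall>j<n. B $$ (i, j) = r i * A $$ (p i, q j) * c j"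
    unfolding monomial_transform_def by auto
  have "B $$ (i, j) \<in> T \<union> {0}" if ij: "i < m" "j < n" for i j
  proof -
    have "p i < m" "q j < n"
      using permutes_in_image[OF p, of i] permutes_in_image[OF q, of j] ij by auto
    then have "A $$ (p i, q j) \<in> T \<union> {0}" using A unfolding mats_over_def by (auto dest!: subsetD)
    then show ?thesis using r c eq ij by (auto simp: subgroup_unit_groupD[OF T])
  qed
  then show ?thesis using B unfolding mats_over_def by (auto dest!: elements_matD)
qed

text \<open>Lexicographic minimality is stated one position at a time, against all competitors with
  the same earlier entries. Positions are index pairs rather than numbers in reading order, so that
  row and column operations can be compared with it directly.\<close>

definition lex_least_in :: "('a \<Rightarrow> 'a \<Rightarrow> bool) \<Rightarrow> nat \<Rightarrow> nat \<Rightarrow> 'a mat set \<Rightarrow> 'a mat \<Rightarrow> bool" where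
  "lex_least_in prec m n X B \<longleftrightarrow> B \<in> X \<and>
     (\<forall>C\<in>X. \<forall>i<m. \<forall>j<n. (\<forall>x y. x < i \<and> y < n \<or> x = i \<and> y < j \<longrightarrow> C $$ (x, y) = B $$ (x, y)) \<longrightarrow>
       B $$ (i, j) = C $$ (i, j) \<or> prec (B $$ (i, j)) (C $$ (i, j)))"

text \<open>The entry \<open>(i, j)\<close> has number \<open>i * n + j\<close> in reading order.
  The bound on \<open>j\<close> keeps this number within row \<open>i\<close>.\<close>

lemma reading_order_less:
  fixes l i j n :: nat
  assumes "j < n"
  shows "l < i * n + j \<longleftrightarrow> l div n < i \<or> l div n = i \<and> l mod n < j"
proof -
  have l: "l = l div n * n + l mod n" and "l mod n < n" using assms by auto
  consider "l div n < i" | "l div n = i" | "i < l div n" by linarith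
  then show ?thesis
  proof cases
    case 1
    then have "Suc (l div n) * n \<le> i * n" by (intro mult_le_mono1) simp
    then have "l < i * n" using l \<open>l mod n < n\<close> unfolding mult_Suc by linarith
    then show ?thesis using 1 by simp
  next
    case 2
    then show ?thesis using l by (metis add_less_cancel_left less_irrefl)
  next
    case 3
    then have "Suc i * n \<le> l div n * n" by (intro mult_le_mono1) simp
    then have "i * n + j < l" using l assms unfolding mult_Suc by linarith
    then show ?thesis using 3 by simp
  qed
qed

lemma lex_least_matrix_exists:
  fixes A :: "'a::{comm_ring, comm_monoid_mult} mat"
  assumes T: "subgroup T unit_group" and ord: "strict_total_order_on (T \<union> {0}) prec"
    and min1: "is_min_of prec (T \<union> {0}) 1"
    and A: "A \<in> mats_over (T \<union> {0}) m n"
    and X: "X = {B \<in> carrier_mat m n. \<exists>p q. monomial_transform T m n p q A B}"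
  shows "\<exists>B. lex_least_in prec m n X B"
proof -
  define f where "f B k = B $$ (k div n, k mod n)" for B :: "'a mat" and k
  have XA: "X \<subseteq> mats_over (T \<union> {0}) m n"
    using monomial_transform_mats_over[OF T A] unfolding X by blast
  have entry: "B $$ (i, j) \<in> T \<union> {0}" if "B \<in> X" "i < m" "j < n" for B i j
    using that XA unfolding mats_over_def by (auto dest!: subsetD)
  have pos: "k div n < m" "k mod n < n" if "k < m * n" for k
    using that by (auto simp: less_mult_imp_div_less intro!: mod_less_divisor gr0I)
  have "\<exists>b\<in>X. \<forall>c\<in>X. \<forall>k<m * n. (\<forall>l<k. f c l = f b l) \<longrightarrow> f b k = f c k \<or> prec (f b k) (f c k)"
  proof (rule lex_least_exists)
    have "A \<in> X" using A monomial_transform_refl[OF T] unfolding X mats_over_def by blast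
    then show "X \<noteq> {}" by blast
    fix B k assume B: "B \<in> X" and k: "k < m * n"
    \<comment> \<open>The competitors at position \<open>k\<close>: it remains to find a least value
      among their entries there.\<close>
    define Y where "Y = {C \<in> X. \<forall>l<k. f C l = f B l}"
    have "\<exists>v\<in>(\<lambda>C. f C k) ` Y. \<forall>w\<in>(\<lambda>C. f C k) ` Y. v = w \<or> prec v w"
    proof (cases "1 \<in> (\<lambda>C. f C k) ` Y")
      case True
      have "f C k \<in> T \<union> {0}" if "C \<in> Y" for C
        using that entry pos[OF k] unfolding f_def Y_def by blast
      with True min1 show ?thesis unfolding is_min_of_def by blast
    next
      case False
      \<comment> \<open>If the same permutations gave two values at \<open>k\<close>, a rescaling
        would put 1 there. It keeps all entries on which \<open>C\<close> and \<open>D\<close>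
        agree, in particular the first \<open>k\<close>, so the rescaled matrix would lie in
        \<open>Y\<close>, against the case assumption.\<close>
      have eq: "f C k = f D k" if CD: "C \<in> Y" "D \<in> Y" and C: "monomial_transform T m n p q A C"
        and D: "monomial_transform T m n p q A D" for C D p q
      proof (rule ccontr)
        assume "f C k \<noteq> f D k"
        moreover have "C \<in> mats_over (T \<union> {0}) m n" using CD XA unfolding Y_def by blast
        ultimately obtain E where E: "E \<in> carrier_mat m n" "monomial_transform T m n id id C E"
          "f E k = 1"
          "\<And>x y. x < m \<Longrightarrow> y < n \<Longrightarrow> C $$ (x, y) = D $$ (x, y) \<Longrightarrow> E $$ (x, y) = C $$ (x, y)"
          using rescaling_free_entry[OF T _ monomial_transform_compare[OF T C D] pos[OF k]]
          unfolding f_def by blast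
        have "E \<in> X" using E(1) monomial_transform_trans[OF T C E(2)] unfolding X by blast
        moreover have "f E l = f B l" if "l < k" for l
        proof -
          have "l < m * n" using that k by simp
          moreover have "f C l = f B l" "f D l = f B l" using CD that unfolding Y_def by auto
          ultimately show ?thesis using E(4) pos unfolding f_def by metis
        qed
        ultimately show False using False E(3) unfolding Y_def by force
      qed
      let ?PQ = "{p. p permutes {..<m}} \<times> {q. q permutes {..<n}}"
      have "\<exists>C pq. C \<in> Y \<and> v = f C k \<and> monomial_transform T m n (fst pq) (snd pq) A C"
        if "v \<in> (\<lambda>C. f C k) ` Y" for v
      proof -
        from that obtain C where C: "C \<in> Y" "v = f C k" by blast
        then obtain p q where "monomial_transform T m n p q A C" unfolding Y_def X by blast
        with C show ?thesis by (intro exI[of _ C] exI[of _ "(p, q)"]) simp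
      qed
      \<comment> \<open>For each value \<open>v\<close> choose a matrix \<open>h v\<close> attaining
        it and a pair \<open>g v\<close> of permutations producing that matrix. By \<open>eq\<close>
        the pair determines the value, so there are at most m! n! values.\<close>
      then obtain h g where hg: "\<And>v. v \<in> (\<lambda>C. f C k) ` Y \<Longrightarrow> h v \<in> Y \<and> v = f (h v) k \<and>
          monomial_transform T m n (fst (g v)) (snd (g v)) A (h v)"
        by metis
      have "inj_on g ((\<lambda>C. f C k) ` Y)"
        by (rule inj_onI) (metis hg eq)
      moreover have "g ` ((\<lambda>C. f C k) ` Y) \<subseteq> ?PQ"
      proof (intro subsetI, elim imageE)
        fix x v C assume "x = g v" "v = f C k" "C \<in> Y"
        then show "x \<in> ?PQ"
          using hg[of v] unfolding monomial_transform_def by (cases "g v") auto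
      qed
      moreover have "finite ?PQ" by (intro finite_cartesian_product finite_permutations) auto
      ultimately have "finite ((\<lambda>C. f C k) ` Y)" by (rule inj_on_finite)
      moreover have "(\<lambda>C. f C k) ` Y \<noteq> {}" using B unfolding Y_def by blast
      moreover have "(\<lambda>C. f C k) ` Y \<subseteq> T \<union> {0}"
        using entry pos[OF k] unfolding f_def Y_def by blast
      ultimately show ?thesis using ord by (rule finite_has_strict_min)
    qed
    then show "\<exists>b'\<in>X. (\<forall>l<k. f b' l = f B l) \<and>
        (\<forall>c\<in>X. (\<forall>l<k. f c l = f B l) \<longrightarrow> f b' k = f c k \<or> prec (f b' k) (f c k))"
      unfolding Y_def by blast
  qed
  then obtain B where B: "B \<in> X" and least: "\<And>C k. C \<in> X \<Longrightarrow> k < m * n \<Longrightarrow>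
      \<forall>l<k. f C l = f B l \<Longrightarrow> f B k = f C k \<or> prec (f B k) (f C k)"
    by blast
  have "B $$ (i, j) = C $$ (i, j) \<or> prec (B $$ (i, j)) (C $$ (i, j))"
    if C: "C \<in> X" and ij: "i < m" "j < n"
      and eq: "\<forall>x y. x < i \<and> y < n \<or> x = i \<and> y < j \<longrightarrow> C $$ (x, y) = B $$ (x, y)" for C i j
  proof -
    have "i * n + j < Suc i * n" using ij by simp
    also have "\<dots> \<le> m * n" using ij by (intro mult_le_mono1) simp
    finally have lt: "i * n + j < m * n" .
    have "f C l = f B l" if "l < i * n + j" for l
    proof -
      have "l mod n < n" using ij by simp
      with that eq show ?thesis unfolding reading_order_less[OF ij(2)] f_def by blast
    qed
    then show ?thesis using least[OF C lt] ij by (simp add: f_def)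
  qed
  then show ?thesis using B unfolding lex_least_in_def by blast
qed

section \<open>A least matrix is in standard form\<close>

lemma lex_least_standard_form:
  fixes A :: "'a::{comm_ring, comm_monoid_mult} mat"
  assumes T: "subgroup T unit_group" and ord: "strict_total_order_on (T \<union> {0}) prec"
    and min1: "is_min_of prec (T \<union> {0}) 1" and max0: "is_max_of prec (T \<union> {0}) 0"
    and "m \<ge> 1"
    and A: "A \<in> mats_over (T \<union> {0}) m n"
    and X: "X = {B \<in> carrier_mat m n. \<exists>p q. monomial_transform T m n p q A B}"
    and least: "lex_least_in prec m n X B"
  shows "standard_form prec B"
proof -
  have BX: "B \<in> X" using least unfolding lex_least_in_def by blast
  then obtain p q where AB: "monomial_transform T m n p q A B" and B: "B \<in> carrier_mat m n"
    unfolding X by blast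
  then have dim [simp]: "dim_row B = m" "dim_col B = n" by auto
  have BT: "B \<in> mats_over (T \<union> {0}) m n" using monomial_transform_mats_over[OF T A B AB] .
  have entry: "B $$ (i, j) \<in> T \<union> {0}" if "i < m" "j < n" for i j
    using that BT unfolding mats_over_def by (auto dest!: subsetD)
  have irrefl: "\<not> prec x y" if "prec y x" "x \<in> T \<union> {0}" "y \<in> T \<union> {0}" for x y
    using ord that transp_onD[of _ prec x y x] irreflp_onD[of _ prec x]
    unfolding strict_total_order_on_def by blast
  \<comment> \<open>The contradiction reached in every case below. Only the entries before
    \<open>(i, j)\<close> in reading order must be unchanged; later ones may change
    arbitrarily.\<close>
  have no_less: False if C: "C \<in> carrier_mat m n" "monomial_transform T m n p' q' B C"
    and ij: "i < m" "j < n"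
    and eq: "\<And>x y. x < m \<Longrightarrow> y < n \<Longrightarrow> x < i \<or> x = i \<and> y < j \<Longrightarrow> C $$ (x, y) = B $$ (x, y)"
    and less: "prec (C $$ (i, j)) (B $$ (i, j))" for C p' q' i j
  proof -
    have CX: "C \<in> X" using C(1) monomial_transform_trans[OF T AB C(2)] unfolding X by blast
    have "C $$ (i, j) \<in> T \<union> {0}"
      using monomial_transform_mats_over[OF T BT C] C(1) ij unfolding mats_over_def
      by (auto dest!: subsetD)
    then have "\<not> prec (B $$ (i, j)) (C $$ (i, j))" and "B $$ (i, j) \<noteq> C $$ (i, j)"
      using irrefl[OF less] less entry[OF ij] by metis+
    moreover have "\<forall>x y. x < i \<and> y < n \<or> x = i \<and> y < j \<longrightarrow> C $$ (x, y) = B $$ (x, y)"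
      using eq ij by auto
    ultimately show False using least CX ij unfolding lex_least_in_def by blast
  qed
  have unit: "\<exists>u\<in>T. u * B $$ (i, j) = 1" if "i < m" "j < n" "B $$ (i, j) \<noteq> 0" for i j
    using entry[OF that(1,2)] that(3) subgroup_unit_groupD(3)[OF T] by blast
  have one_less: "prec 1 (B $$ (i, j))" if "i < m" "j < n" "B $$ (i, j) \<noteq> 1" for i j
    using min1 entry[OF that(1,2)] that(3) unfolding is_min_of_def by metis
  \<comment> \<open>Multiplying row \<open>i\<close> by the inverse of its first non-zero entry
    changes no earlier position, since the entries to the left are zero.\<close>
  have row1: "B $$ (i, k) = 1" if i: "i < m" and k: "k < n" "B $$ (i, k) \<noteq> 0"
    and zero: "\<And>j. j < k \<Longrightarrow> B $$ (i, j) = 0" for i k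
  proof (rule ccontr)
    assume ne: "B $$ (i, k) \<noteq> 1"
    obtain u where u: "u \<in> T" "u * B $$ (i, k) = 1" using unit i k by blast
    define C where "C = mat m n (\<lambda>(x, y). (if x = i then u else 1) * B $$ (x, y) * 1)"
    have "C \<in> carrier_mat m n" by (simp add: C_def)
    moreover have "monomial_transform T m n id id B C"
      unfolding monomial_transform_def C_def
      by (intro conjI permutes_id exI[of _ "\<lambda>x. if x = i then u else 1"] exI[of _ "\<lambda>_. 1"])
        (auto simp: u subgroup_unit_groupD[OF T])
    ultimately show False
    proof (rule no_less)
      show "prec (C $$ (i, k)) (B $$ (i, k))" using one_less[OF i k(1) ne] i k u by (simp add: C_def)
    qed (use i k zero in \<open>auto simp: C_def\<close>)
  qed
  \<comment> \<open>Column \<open>j\<close> is zero above row \<open>k\<close>, and earlier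
    positions of row \<open>k\<close> lie in other columns, so scaling column \<open>j\<close> first
    has an effect at \<open>(k, j)\<close>.\<close>
  have col1: "B $$ (k, j) = 1" if j: "j < n" and k: "k < m" "B $$ (k, j) \<noteq> 0"
    and zero: "\<And>i. i < k \<Longrightarrow> B $$ (i, j) = 0" for j k
  proof (rule ccontr)
    assume ne: "B $$ (k, j) \<noteq> 1"
    obtain u where u: "u \<in> T" "u * B $$ (k, j) = 1" using unit j k by blast
    define C where "C = mat m n (\<lambda>(x, y). 1 * B $$ (x, y) * (if y = j then u else 1))"
    have "C \<in> carrier_mat m n" by (simp add: C_def)
    moreover have "monomial_transform T m n id id B C"
      unfolding monomial_transform_def C_def
      by (intro conjI permutes_id exI[of _ "\<lambda>_. 1"] exI[of _ "\<lambda>y. if y = j then u else 1"])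
        (auto simp: u subgroup_unit_groupD[OF T])
    ultimately show False
    proof (rule no_less)
      show "prec (C $$ (k, j)) (B $$ (k, j))"
        using one_less[OF k(1) j ne] j k u by (simp add: C_def mult.commute)
    qed (use j k zero in \<open>auto simp: C_def\<close>)
  qed
  have "first_nonzero_is_1 (row B i)" if "i < m" for i
    using that row1 unfolding first_nonzero_is_1_def by auto
  moreover have "first_nonzero_is_1 (col B j)" if "j < n" for j
    using that col1 unfolding first_nonzero_is_1_def by auto
  moreover have "\<exists>r\<le>n. row B 0 = vec n (\<lambda>j. if j < r then 1 else 0)"
  proof -
    \<comment> \<open>The column of the first zero in row 0; the alternative \<open>j = n\<close>
      covers a row without zeros.\<close>
    define r where "r = (LEAST j. j = n \<or> B $$ (0, j) = 0)"
    have r: "r = n \<or> B $$ (0, r) = 0" unfolding r_def by (rule LeastI[of _ n]) simp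
    have rn: "r \<le> n" unfolding r_def by (rule Least_le) simp
    have m0: "0 < m" using \<open>m \<ge> 1\<close> by simp
    \<comment> \<open>A non-zero entry of row 0 is the first non-zero entry of its column, so
      \<open>col1\<close> applies with an empty condition above it.\<close>
    have "B $$ (0, j) = 1" if "j < r" for j
      using not_less_Least[OF that[unfolded r_def]] that rn col1[of j 0] m0 by auto
    \<comment> \<open>Otherwise \<open>j > r\<close>, and swapping columns \<open>r\<close> and
      \<open>j\<close> replaces the 0 at \<open>(0, r)\<close>, the greatest element, by a smaller
      one. The columns before \<open>r\<close> stay fixed, and the lower rows come later in reading
      order.\<close>
    moreover have "B $$ (0, j) = 0" if j: "j < n" "\<not> j < r" for j
    proof (rule ccontr)
      assume ne: "B $$ (0, j) \<noteq> 0"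
      have r0: "B $$ (0, r) = 0" "r < n" using r rn j by auto
      define s where "s = Transposition.transpose r j"
      have s: "s permutes {..<n}" unfolding s_def
        by (rule permutes_swap_id) (use r0 j in auto)
      define C where "C = mat m n (\<lambda>(x, y). 1 * B $$ (x, s y) * 1)"
      have "C \<in> carrier_mat m n" by (simp add: C_def)
      moreover have "monomial_transform T m n id s B C"
        unfolding monomial_transform_def C_def
        by (intro conjI permutes_id s exI[of _ "\<lambda>_. 1"]) (auto simp: subgroup_unit_groupD[OF T])
      ultimately show False
      proof (rule no_less)
        have "prec (B $$ (0, j)) 0" using max0 entry[OF m0 j(1)] ne unfolding is_max_of_def by metis
        then show "prec (C $$ (0, r)) (B $$ (0, r))" using m0 r0 by (simp add: C_def s_def)
      qed (use m0 r0 j in \<open>auto simp: C_def s_def Transposition.transpose_def\<close>)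
    qed
    ultimately have "row B 0 = vec n (\<lambda>j. if j < r then 1 else 0)"
      using m0 by (intro eq_vecI) auto
    with rn show ?thesis by blast
  qed
  \<comment> \<open>If two adjacent rows are out of order, swapping them puts the smaller entry into
    row \<open>i\<close> at the first column \<open>k\<close> where they differ. Rows above
    \<open>i\<close> and the columns before \<open>k\<close> in row \<open>i\<close> keep their
    entries.\<close>
  moreover have "lex_le prec (row B i) (row B (Suc i))" if i: "Suc i < m" for i
  proof (rule ccontr)
    assume not_le: "\<not> lex_le prec (row B i) (row B (Suc i))"
    then have "row B i \<noteq> row B (Suc i)" unfolding lex_le_def by blast
    moreover have "row B i = row B (Suc i)" if "\<forall>k<n. B $$ (i, k) = B $$ (Suc i, k)"
      using that i by (intro eq_vecI) auto
    ultimately have ex: "\<exists>k. k < n \<and> B $$ (i, k) \<noteq> B $$ (Suc i, k)" by blast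
    define k where "k = (LEAST k. k < n \<and> B $$ (i, k) \<noteq> B $$ (Suc i, k))"
    have k: "k < n" "B $$ (i, k) \<noteq> B $$ (Suc i, k)"
      using LeastI_ex[OF ex] unfolding k_def by auto
    have before: "B $$ (i, j) = B $$ (Suc i, j)" if "j < k" for j
      using not_less_Least[OF that[unfolded k_def]] that k(1) by auto
    have "\<not> prec (B $$ (i, k)) (B $$ (Suc i, k))"
    proof
      assume "prec (B $$ (i, k)) (B $$ (Suc i, k))"
      then have "lex_less prec (row B i) (row B (Suc i))"
        unfolding lex_less_def using i k before by (intro exI[of _ k]) auto
      with not_le show False unfolding lex_le_def by blast
    qed
    then have less: "prec (B $$ (Suc i, k)) (B $$ (i, k))"
      using ord entry[OF Suc_lessD[OF i] k(1)] entry[OF i k(1)] k(2)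
      unfolding strict_total_order_on_def totalp_on_def by blast
    define s where "s = Transposition.transpose i (Suc i)"
    have s: "s permutes {..<m}" unfolding s_def
      by (rule permutes_swap_id) (use i in auto)
    define C where "C = mat m n (\<lambda>(x, y). 1 * B $$ (s x, y) * 1)"
    have "C \<in> carrier_mat m n" by (simp add: C_def)
    moreover have "monomial_transform T m n s id B C"
      unfolding monomial_transform_def C_def
      by (intro conjI permutes_id s exI[of _ "\<lambda>_. 1"]) (auto simp: subgroup_unit_groupD[OF T])
    ultimately show False
    proof (rule no_less)
      show "prec (C $$ (i, k)) (B $$ (i, k))" using i k less by (simp add: C_def s_def)
    qed (use i k before in \<open>auto simp: C_def s_def Transposition.transpose_def\<close>)
  qed
  ultimately show ?thesis unfolding standard_form_def by simp
qed

theorem theorem2p3: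
  fixes T T0 :: "'a::{comm_ring, comm_monoid_mult} set"
    and prec :: "'a \<Rightarrow> 'a \<Rightarrow> bool"
    and m n :: nat
    and A :: "'a mat"
  assumes "subgroup T unit_group"
    and "T0 = T \<union> {0}"
    and "strict_total_order_on T0 prec"
    and "is_min_of prec T0 1"
    and "is_max_of prec T0 0"
    and "m \<ge> 1" and "n \<ge> 1"
    and "A \<in> mats_over T0 m n"
  shows "\<exists>B \<in> mats_over T0 m n. mat_equivalent T A B \<and> standard_form prec B"
proof -
  define X where "X = {B \<in> carrier_mat m n. \<exists>p q. monomial_transform T m n p q A B}"
  note hyps = assms(1,3-5,8)[unfolded assms(2)]
  obtain B where least: "lex_least_in prec m n X B"
    using lex_least_matrix_exists[OF hyps(1-3,5) X_def] by blast
  then obtain p q where AB: "B \<in> carrier_mat m n" "monomial_transform T m n p q A B"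
    unfolding lex_least_in_def X_def by blast
  have "A \<in> carrier_mat m n" using assms(8) unfolding mats_over_def by blast
  then have "mat_equivalent T A B" using mat_equivalent_iff_monomial_transform AB by blast
  moreover have "B \<in> mats_over T0 m n"
    using monomial_transform_mats_over[OF hyps(1,5) AB] by (simp add: assms(2))
  moreover have "standard_form prec B"
    using lex_least_standard_form[OF hyps(1-4) assms(6) hyps(5) X_def least] .
  ultimately show ?thesis by blast
qed

end
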